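(* Let $R$ be an associative ring, $\lambda$ be an infinite cardinal, and $\mathbb G$ be a right Gabriel topology on $R$ satisfying (T$_\lambda$) and having a base consisting of finitely generated right ideals. Let $\Xi$ denote the set of all Gabriel topologies $\mathbb H\subset\mathbb G$ having a base of cardinality not exceeding $\lambda$ consisting of finitely generated right ideals. Then the set $\Xi$ is $\lambda^+$-directed by inclusion and one has $\mathbb G=\bigcup_{\mathbb H\in\Xi}\mathbb H$.
   Context: Rings are associative and unital. A right Gabriel topology on $R$ is a set $\mathbb G$ of right ideals such that: (T0) $R\in\mathbb G$; (T1) a right ideal containing an element of $\mathbb G$ is in $\mathbb G$; (T2) $I,J\in\mathbb G$ implies $I\cap J\in\mathbb G$; (T3) $I\in\mathbb G$, $s\in R$ implies $(I:s)=\{r\in R: sr\in I\}\in\mathbb G$; (T4) if $I$ is a right ideal and there is $J\in\mathbb G$ with $(I:s)\in\mathbb G$ for all $s\in J$, then $I\in\mathbb G$. A base of $\mathbb G$ is a subset $\mathbb B\subset\mathbb G$ such that every element of $\mathbb G$ contains an element of $\mathbb B$. Condition (T$_\lambda$): for every $I\in\mathbb G$ there is a subset $F_I\subset\mathbb G$ of cardinality not exceeding $\lambda$ such that for every $s\in R$ there exists $J\in F_I$ with $sJ\subset I$. A poset $\Xi$ is $\lambda^+$-directed if every subset $\Upsilon\subset\Xi$ of cardinality not exceeding $\lambda$ has an upper bound in $\Xi$. *)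

theory Defs
  imports "HOL-Algebra.Ideal"
begin

unbundle cardinal_syntax

text \<open>
  HOL-Algebra's \<open>ideal\<close> is two-sided; \<open>right_ideal\<close> drops its left closure axiom, and
  \<open>genrideal\<close> is the corresponding variant of \<open>genideal\<close>. Rings in HOL-Algebra are
  associative and unital, need not be commutative, and may be zero.
\<close>

locale right_ideal = additive_subgroup I R + ring R for I and R (structure) +
  assumes I_r_closed: "\<lbrakk>a \<in> I; x \<in> carrier R\<rbrakk> \<Longrightarrow> a \<otimes> x \<in> I"

definition genrideal :: "('a, 'b) ring_scheme \<Rightarrow> 'a set \<Rightarrow> 'a set" where
  "genrideal R S = \<Inter>{I. right_ideal I R \<and> S \<subseteq> I}"

definition fg_right_ideal :: "('a, 'b) ring_scheme \<Rightarrow> 'a set \<Rightarrow> bool" where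
  "fg_right_ideal R I \<longleftrightarrow> (\<exists>S. finite S \<and> S \<subseteq> carrier R \<and> I = genrideal R S)"

definition rcolon :: "('a, 'b) ring_scheme \<Rightarrow> 'a set \<Rightarrow> 'a \<Rightarrow> 'a set" where
  "rcolon R I s = {r \<in> carrier R. s \<otimes>\<^bsub>R\<^esub> r \<in> I}"

locale right_gabriel_topology = ring R for R (structure) +
  fixes G :: "'a set set"
  assumes right_ideals: "I \<in> G \<Longrightarrow> right_ideal I R"
    and T0: "carrier R \<in> G"
    and T1: "\<lbrakk>J \<in> G; right_ideal I R; J \<subseteq> I\<rbrakk> \<Longrightarrow> I \<in> G"
    and T2: "\<lbrakk>I \<in> G; J \<in> G\<rbrakk> \<Longrightarrow> I \<inter> J \<in> G"
    and T3: "\<lbrakk>I \<in> G; s \<in> carrier R\<rbrakk> \<Longrightarrow> rcolon R I s \<in> G"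
    and T4: "\<lbrakk>right_ideal I R; J \<in> G; \<And>s. s \<in> J \<Longrightarrow> rcolon R I s \<in> G\<rbrakk> \<Longrightarrow> I \<in> G"

definition topology_base :: "'a set set \<Rightarrow> 'a set set \<Rightarrow> bool" where
  "topology_base G B \<longleftrightarrow> B \<subseteq> G \<and> (\<forall>I\<in>G. \<exists>J\<in>B. J \<subseteq> I)"

text \<open>
  Below, \<open>\<lambda>\<close> is a cardinal in the sense of the HOL cardinals library, i.e. a well-order
  \<open>l\<close> on an arbitrary type with \<open>Card_order l\<close>; thus \<open>|A| \<le>o l\<close> says that the cardinality
  of \<open>A\<close> does not exceed \<open>\<lambda>\<close>.
\<close>

text \<open>The coset notation \<open>s <# J\<close> is the set \<open>sJ\<close>.\<close>

definition cond_T :: "('a, 'b) ring_scheme \<Rightarrow> 'c rel \<Rightarrow> 'a set set \<Rightarrow> bool" where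
  "cond_T R l G \<longleftrightarrow>
    (\<forall>I\<in>G. \<exists>F\<subseteq>G. |F| \<le>o l \<and> (\<forall>s\<in>carrier R. \<exists>J\<in>F. s <#\<^bsub>R\<^esub> J \<subseteq> I))"

text \<open>\<open>\<lambda>\<^sup>+\<close>-directedness, for a subset of an ordered type with the induced order.\<close>

definition succ_directed :: "'c rel \<Rightarrow> 'a::order set \<Rightarrow> bool" where
  "succ_directed l X \<longleftrightarrow> (\<forall>Y\<subseteq>X. |Y| \<le>o l \<longrightarrow> (\<exists>u\<in>X. \<forall>y\<in>Y. y \<le> u))"

definition small_subtopologies ::
    "('a, 'b) ring_scheme \<Rightarrow> 'c rel \<Rightarrow> 'a set set \<Rightarrow> 'a set set set" where
  "small_subtopologies R l G =
    {H. H \<subseteq> G \<and> right_gabriel_topology R H \<and>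
        (\<exists>B. topology_base H B \<and> |B| \<le>o l \<and> (\<forall>I\<in>B. fg_right_ideal R I))}"

end

theory Submission
  imports Defs
begin

text \<open>
  The idea is a downward Loewenheim-Skolem argument. A set \<open>C\<close> of finitely generated
  members of \<open>G\<close> is a base of a Gabriel topology as soon as it has three closure properties,
  each asking \<open>C\<close> to be closed under an operation with at most \<open>\<lambda>\<close> values:
  below \<open>I \<inter> J\<close> there is a member of \<open>C\<close>; for every \<open>s\<close> there is \<open>K \<in> C\<close> with \<open>sK \<subseteq> I\<close>; and
  below the right ideal generated by \<open>s\<^sub>1K, \<dots>, s\<^sub>nK\<close> there is a member of \<open>C\<close>, where
  \<open>s\<^sub>1, \<dots>, s\<^sub>n\<close> generate \<open>J\<close>.

  In the second property \<open>s\<close> ranges over all of \<open>R\<close>, which may be larger than \<open>\<lambda>\<close>: this is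
  where (T\<open>\<^sub>\<lambda>\<close>) enters, because it bounds by \<open>\<lambda>\<close> the number of \<open>K\<close> that are required. The third
  property replaces (T4), whose hypothesis involves arbitrary right ideals of \<open>R\<close> and all
  elements of \<open>J\<close>: if \<open>(I : s) \<in> H\<close> for all \<open>s \<in> J\<close>, then, \<open>J\<close> being finitely generated, finitely
  many of these memberships have a common witness \<open>K \<in> C\<close>, and \<open>I\<close> contains the right ideal
  generated by the \<open>s\<^sub>iK\<close>. That right ideal lies in \<open>G\<close> by \<open>genrideal_products_mem\<close>.

  So every set of at most \<open>\<lambda>\<close> members of \<open>G\<close> can be enlarged by \<open>small_closure\<close> to
  a base of size at most \<open>\<lambda>\<close>, which is \<open>ex_small_subtopology\<close>. Applied to the union of given bases it yields an
  upper bound of the topologies that they generate; applied to one member of \<open>G\<close> it yields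
  a small topology that contains it.
\<close>

section \<open>Closing a small set under small-valued operations\<close>

lemma finite_ordLeq_infinite_card:
  assumes "Card_order l" "infinite (Field l)" "finite A"
  shows "|A| \<le>o l"
  using assms
  by (intro ordLess_imp_ordLeq finite_ordLess_infinite card_order_on_well_order_on)
    (simp_all add: Field_card_of card_of_card_order_on)

text \<open>Iterating one closure step countably often suffices because the step takes only two
  arguments; each stage stays small since the infinite cardinal \<open>l\<close> absorbs unions.\<close>

lemma small_closure:
  fixes \<Phi> :: "'a \<Rightarrow> 'a \<Rightarrow> 'a set"
  assumes l: "Card_order l" "infinite (Field l)"
    and X: "X \<subseteq> P" "|X| \<le>o l"
    and \<Phi>: "\<And>x y. \<lbrakk>x \<in> P; y \<in> P\<rbrakk> \<Longrightarrow> \<Phi> x y \<subseteq> P"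
      "\<And>x y. \<lbrakk>x \<in> P; y \<in> P\<rbrakk> \<Longrightarrow> |\<Phi> x y| \<le>o l"
  obtains C where "X \<subseteq> C" "C \<subseteq> P" "|C| \<le>o l" "\<And>x y. \<lbrakk>x \<in> C; y \<in> C\<rbrakk> \<Longrightarrow> \<Phi> x y \<subseteq> C"
proof -
  define step where "step C = C \<union> (\<Union>x\<in>C. \<Union>y\<in>C. \<Phi> x y)" for C
  define stage where "stage n = (step ^^ n) X" for n
  have stage_0: "stage 0 = X" and stage_Suc: "stage (Suc n) = step (stage n)" for n
    by (simp_all add: stage_def)
  have stage: "stage n \<subseteq> P \<and> |stage n| \<le>o l" for n
  proof (induction n)
    case 0
    show ?case using X by (simp add: stage_0)
  next
    case (Suc n)
    let ?C = "stage n"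
    have "|\<Union>x\<in>?C. \<Union>y\<in>?C. \<Phi> x y| \<le>o l"
      using Suc \<Phi>(2) l by (intro card_of_UNION_ordLeq_infinite_Field ballI) auto
    then have "|step ?C| \<le>o l"
      unfolding step_def using Suc l by (intro card_of_Un_ordLeq_infinite_Field) auto
    moreover have "step ?C \<subseteq> P"
      unfolding step_def using Suc \<Phi>(1) by blast
    ultimately show ?case by (simp add: stage_Suc)
  qed
  have mono: "stage m \<subseteq> stage n" if "m \<le> n" for m n
    using that by (rule lift_Suc_mono_le[rotated]) (auto simp: stage_Suc step_def)
  show thesis
  proof
    show "X \<subseteq> (\<Union>n. stage n)" using stage_0 by blast
    show "(\<Union>n. stage n) \<subseteq> P" using stage by blast
    have "|UNIV :: nat set| \<le>o l"
      using l infinite_iff_card_of_nat card_of_Field_ordIso ordLeq_ordIso_trans by blast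
    then show "|\<Union>n. stage n| \<le>o l"
      using stage l by (intro card_of_UNION_ordLeq_infinite_Field) auto
    show "\<Phi> x y \<subseteq> (\<Union>n. stage n)" if xy: "x \<in> (\<Union>n. stage n)" "y \<in> (\<Union>n. stage n)" for x y
    proof -
      obtain i j where "x \<in> stage i" "y \<in> stage j" using xy by blast
      then have "x \<in> stage (max i j)" "y \<in> stage (max i j)"
        using mono[of i "max i j"] mono[of j "max i j"] by auto
      then have "\<Phi> x y \<subseteq> stage (Suc (max i j))" unfolding stage_Suc step_def by blast
      then show ?thesis by blast
    qed
  qed
qed

section \<open>Right ideals\<close>

lemma right_ideal_subset: "right_ideal I R \<Longrightarrow> I \<subseteq> carrier R"
  by (simp add: right_ideal_def additive_subgroup.a_subset)

context ring
begin

lemma right_idealI: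
  assumes "I \<subseteq> carrier R" "\<zero> \<in> I"
    and add: "\<And>x y. \<lbrakk>x \<in> I; y \<in> I\<rbrakk> \<Longrightarrow> x \<oplus> y \<in> I"
    and mult: "\<And>x r. \<lbrakk>x \<in> I; r \<in> carrier R\<rbrakk> \<Longrightarrow> x \<otimes> r \<in> I"
  shows "right_ideal I R"
proof -
  have "\<ominus> x \<in> I" if "x \<in> I" for x
    using mult[OF that, of "\<ominus> \<one>"] that assms(1) by (auto simp: r_minus)
  then have "subgroup I (add_monoid R)"
    using assms by (intro subgroup.intro) (auto simp: a_inv_def)
  then show ?thesis
    using mult
    by (intro right_ideal.intro right_ideal_axioms.intro additive_subgroup.intro ring_axioms)
qed

lemma right_ideal_carrier: "right_ideal (carrier R) R"
  by (rule right_idealI) auto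

lemma right_ideal_Int:
  assumes "right_ideal I R" "right_ideal J R"
  shows "right_ideal (I \<inter> J) R"
proof -
  interpret I: right_ideal I R by fact
  interpret J: right_ideal J R by fact
  show ?thesis
    using I.a_subset by (intro right_idealI) (auto intro: I.I_r_closed J.I_r_closed)
qed

lemma right_ideal_genrideal:
  assumes "S \<subseteq> carrier R"
  shows "right_ideal (genrideal R S) R"
proof (rule right_idealI)
  show "genrideal R S \<subseteq> carrier R"
    unfolding genrideal_def using assms right_ideal_carrier by blast
next
  show "\<zero> \<in> genrideal R S"
    by (auto simp: genrideal_def intro: additive_subgroup.zero_closed dest: right_ideal.axioms(1))
  show "x \<oplus> y \<in> genrideal R S" if "x \<in> genrideal R S" "y \<in> genrideal R S" for x y
    using that unfolding genrideal_def
    by (blast intro: additive_subgroup.a_closed dest: right_ideal.axioms(1))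
  show "x \<otimes> r \<in> genrideal R S" if "x \<in> genrideal R S" "r \<in> carrier R" for x r
    using that unfolding genrideal_def by (blast intro: right_ideal.I_r_closed)
qed

lemma right_ideal_rcolon:
  assumes "right_ideal I R" "s \<in> carrier R"
  shows "right_ideal (rcolon R I s) R"
proof -
  interpret I: right_ideal I R by fact
  show ?thesis
  proof (rule right_idealI)
    fix x r assume "x \<in> rcolon R I s" "r \<in> carrier R"
    then show "x \<otimes> r \<in> rcolon R I s"
      using I.I_r_closed[of "s \<otimes> x" r] assms(2) by (simp add: rcolon_def m_assoc)
  qed (use assms(2) in \<open>auto simp: rcolon_def r_distr\<close>)
qed

end

lemma subset_genrideal: "S \<subseteq> genrideal R S"
  by (auto simp: genrideal_def)

lemma genrideal_minimal: "\<lbrakk>right_ideal I R; S \<subseteq> I\<rbrakk> \<Longrightarrow> genrideal R S \<subseteq> I"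
  by (auto simp: genrideal_def)

lemma l_coset_subset_iff_rcolon:
  assumes "K \<subseteq> carrier R"
  shows "s <#\<^bsub>R\<^esub> K \<subseteq> I \<longleftrightarrow> K \<subseteq> rcolon R I s"
  using assms by (auto simp: l_coset_def rcolon_def)

section \<open>Products inside a Gabriel topology\<close>

context right_gabriel_topology
begin

text \<open>This allows a property of all elements of a right ideal, as in (T4), to be checked
  on generators.\<close>

lemma right_ideal_rcolon_mem:
  assumes L: "right_ideal L R"
  shows "right_ideal {s \<in> carrier R. rcolon R L s \<in> G} R"
proof -
  interpret L: right_ideal L R by fact
  show ?thesis
  proof (rule right_idealI)
    have "rcolon R L \<zero> = carrier R" by (auto simp: rcolon_def)
    then show "\<zero> \<in> {s \<in> carrier R. rcolon R L s \<in> G}" using T0 by simp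
  next
    fix x y
    assume xy: "x \<in> {s \<in> carrier R. rcolon R L s \<in> G}" "y \<in> {s \<in> carrier R. rcolon R L s \<in> G}"
    then have "rcolon R L x \<inter> rcolon R L y \<subseteq> rcolon R L (x \<oplus> y)"
      by (auto simp: rcolon_def l_distr)
    then show "x \<oplus> y \<in> {s \<in> carrier R. rcolon R L s \<in> G}"
      using xy T1[OF T2 right_ideal_rcolon[OF L]] by blast
  next
    fix x r
    assume xr: "x \<in> {s \<in> carrier R. rcolon R L s \<in> G}" "r \<in> carrier R"
    then have "rcolon R L (x \<otimes> r) = rcolon R (rcolon R L x) r"
      by (auto simp: rcolon_def m_assoc)
    then show "x \<otimes> r \<in> {s \<in> carrier R. rcolon R L s \<in> G}" using xr T3 by simp
  qed auto
qed

text \<open>For commutative \<open>R\<close> this says that the product of two members of \<open>G\<close> is in \<open>G\<close>. In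
  general the right ideal generated by the sets \<open>sK\<close> depends on the generating set \<open>S\<close> and not
  only on \<open>J = genrideal R S\<close>, but (T4) can be applied to it along \<open>J\<close>: its colon by a
  generator \<open>s\<close> contains \<open>K\<close>, and \<open>right_ideal_rcolon_mem\<close> carries this over to all of \<open>J\<close>.\<close>

lemma genrideal_products_mem:
  assumes S: "S \<subseteq> carrier R" "genrideal R S \<in> G" and K: "K \<in> G"
  shows "genrideal R (\<Union>s\<in>S. s <# K) \<in> G"
proof -
  let ?L = "genrideal R (\<Union>s\<in>S. s <# K)"
  have Ksub: "K \<subseteq> carrier R" using right_ideal_subset[OF right_ideals[OF K]] .
  then have L: "right_ideal ?L R"
    using S(1) by (intro right_ideal_genrideal) (auto simp: l_coset_def)
  have "rcolon R ?L s \<in> G" if s: "s \<in> S" for s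
  proof (rule T1[OF K])
    show "right_ideal (rcolon R ?L s) R" using L S(1) s by (blast intro: right_ideal_rcolon)
    have "s <# K \<subseteq> (\<Union>s\<in>S. s <# K)" using s by blast
    also have "\<dots> \<subseteq> ?L" by (rule subset_genrideal)
    finally show "K \<subseteq> rcolon R ?L s" by (simp only: l_coset_subset_iff_rcolon[OF Ksub])
  qed
  then have "genrideal R S \<subseteq> {s \<in> carrier R. rcolon R ?L s \<in> G}"
    using S(1) by (intro genrideal_minimal right_ideal_rcolon_mem[OF L]) auto
  then show ?thesis using T4[OF L S(2)] by blast
qed

end

section \<open>Small bases of Gabriel topologies\<close>

text \<open>The elementwise axioms are expressed through \<open>C\<close> alone, so that \<open>C\<close> can be produced by
  a closure argument. The function \<open>gens\<close> fixes one generating set per member of \<open>C\<close>,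
  which leaves only one condition for each pair \<open>J\<close>, \<open>K\<close> in the last assumption.\<close>

lemma (in ring) right_gabriel_topology_of_base:
  fixes C :: "'a set set" and gens :: "'a set \<Rightarrow> 'a set"
  defines "H \<equiv> {I. right_ideal I R \<and> (\<exists>J\<in>C. J \<subseteq> I)}"
  assumes ideals: "\<And>I. I \<in> C \<Longrightarrow> right_ideal I R" and ne: "C \<noteq> {}"
    and gens: "\<And>J. J \<in> C \<Longrightarrow> finite (gens J)" "\<And>J. J \<in> C \<Longrightarrow> gens J \<subseteq> J"
    and inter: "\<And>I J. \<lbrakk>I \<in> C; J \<in> C\<rbrakk> \<Longrightarrow> \<exists>K\<in>C. K \<subseteq> I \<inter> J"
    and colon: "\<And>I s. \<lbrakk>I \<in> C; s \<in> carrier R\<rbrakk> \<Longrightarrow> \<exists>K\<in>C. s <# K \<subseteq> I"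
    and products: "\<And>J K. \<lbrakk>J \<in> C; K \<in> C\<rbrakk> \<Longrightarrow> \<exists>L\<in>C. L \<subseteq> genrideal R (\<Union>s\<in>gens J. s <# K)"
  shows "right_gabriel_topology R H"
proof (intro right_gabriel_topology.intro right_gabriel_topology_axioms.intro ring_axioms)
  have sub: "K \<subseteq> carrier R" if "K \<in> C" for K using right_ideal_subset[OF ideals[OF that]] .
  show "right_ideal I R" if "I \<in> H" for I using that by (simp add: H_def)
  show "carrier R \<in> H" using ne sub right_ideal_carrier by (auto simp: H_def)
  show "I \<in> H" if "J \<in> H" "right_ideal I R" "J \<subseteq> I" for I J
    using that by (auto simp: H_def)
  show "I \<inter> J \<in> H" if IJ: "I \<in> H" "J \<in> H" for I J
  proof -
    obtain I' J' where "I' \<in> C" "I' \<subseteq> I" "J' \<in> C" "J' \<subseteq> J"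
      using IJ by (auto simp: H_def)
    then have "\<exists>K\<in>C. K \<subseteq> I \<inter> J" using inter[of I' J'] by blast
    moreover have "right_ideal (I \<inter> J) R"
      using IJ by (intro right_ideal_Int) (simp_all add: H_def)
    ultimately show ?thesis by (simp add: H_def)
  qed
  show "rcolon R I s \<in> H" if I: "I \<in> H" and s: "s \<in> carrier R" for I s
  proof -
    obtain J where "J \<in> C" "J \<subseteq> I" using I by (auto simp: H_def)
    then obtain K where "K \<in> C" "s <# K \<subseteq> I" using colon[of J s] s by blast
    then have "K \<subseteq> rcolon R I s" using sub by (simp add: l_coset_subset_iff_rcolon)
    moreover have "right_ideal (rcolon R I s) R"
      using I s by (intro right_ideal_rcolon) (simp_all add: H_def)
    ultimately show ?thesis using \<open>K \<in> C\<close> by (auto simp: H_def)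
  qed
  show "I \<in> H"
    if I: "right_ideal I R" and J: "J \<in> H" and IJ: "\<And>s. s \<in> J \<Longrightarrow> rcolon R I s \<in> H" for I J
  proof -
    obtain J' where J': "J' \<in> C" "J' \<subseteq> J" using J by (auto simp: H_def)
    have common: "\<exists>K\<in>C. \<forall>s\<in>S. s <# K \<subseteq> I" if "finite S" "S \<subseteq> J" for S
      using that
    proof (induction S rule: finite_induct)
      case empty
      then show ?case using ne by auto
    next
      case (insert s S)
      then obtain K where K: "K \<in> C" "\<forall>t\<in>S. t <# K \<subseteq> I" by auto
      obtain K' where K': "K' \<in> C" "K' \<subseteq> rcolon R I s"
        using insert.prems IJ[of s] by (auto simp: H_def)
      obtain K'' where K'': "K'' \<in> C" "K'' \<subseteq> K \<inter> K'" using inter K(1) K'(1) by blast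
      have "t <# K'' \<subseteq> I" if "t \<in> insert s S" for t
      proof (cases "t = s")
        case True
        have "K'' \<subseteq> rcolon R I s" using K'(2) K''(2) by blast
        with True show ?thesis by (simp add: l_coset_subset_iff_rcolon[OF sub[OF K''(1)]])
      next
        case False
        with that K(2) have "t <# K \<subseteq> I" by blast
        then show ?thesis using K''(2) by (auto simp: l_coset_def)
      qed
      then show ?case using K''(1) by blast
    qed
    obtain K where K: "K \<in> C" "\<forall>s\<in>gens J'. s <# K \<subseteq> I"
      using common[of "gens J'"] gens[OF J'(1)] J'(2) by blast
    obtain L where "L \<in> C" "L \<subseteq> genrideal R (\<Union>s\<in>gens J'. s <# K)"
      using products J'(1) K(1) by blast
    moreover have "genrideal R (\<Union>s\<in>gens J'. s <# K) \<subseteq> I"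
      using K(2) by (intro genrideal_minimal I) blast
    ultimately show ?thesis using I by (auto simp: H_def)
  qed
qed

text \<open>Only the condition on \<open>sK \<subseteq> I\<close> has as many instances as \<open>R\<close> has elements; (T\<open>\<^sub>\<lambda>\<close>)
  supplies a set \<open>F I\<close> of at most \<open>\<lambda>\<close> right ideals that serves all of them.\<close>

lemma (in right_gabriel_topology) ex_small_subtopology:
  fixes l :: "'c rel"
  assumes l: "Card_order l" "infinite (Field l)"
    and T: "cond_T R l G"
    and base: "topology_base G B" "\<forall>I\<in>B. fg_right_ideal R I"
    and X: "X \<subseteq> G" "|X| \<le>o l"
  obtains H where "H \<in> small_subtopologies R l G" "X \<subseteq> H"
proof -
  have BG: "B \<subseteq> G" using base(1) by (simp add: topology_base_def)
  obtain \<beta> where \<beta>: "\<And>I. I \<in> G \<Longrightarrow> \<beta> I \<in> B" "\<And>I. I \<in> G \<Longrightarrow> \<beta> I \<subseteq> I"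
    using base(1) unfolding topology_base_def by metis
  obtain gens where gens: "\<And>I. I \<in> B \<Longrightarrow> finite (gens I)" "\<And>I. I \<in> B \<Longrightarrow> gens I \<subseteq> carrier R"
      "\<And>I. I \<in> B \<Longrightarrow> genrideal R (gens I) = I"
    using base(2) unfolding fg_right_ideal_def by metis
  obtain F where F: "\<And>I. I \<in> G \<Longrightarrow> F I \<subseteq> G" "\<And>I. I \<in> G \<Longrightarrow> |F I| \<le>o l"
      "\<And>I s. \<lbrakk>I \<in> G; s \<in> carrier R\<rbrakk> \<Longrightarrow> \<exists>J\<in>F I. s <# J \<subseteq> I"
    using T unfolding cond_T_def by metis
  define prod where "prod J K = genrideal R (\<Union>s\<in>gens J. s <# K)" for J K
  define \<Phi> where "\<Phi> I J = {\<beta> (I \<inter> J), \<beta> (prod I J)} \<union> \<beta> ` F I" for I J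
  have prod: "prod J K \<in> G" if "J \<in> B" "K \<in> B" for J K
    unfolding prod_def
  proof (rule genrideal_products_mem)
    show "gens J \<subseteq> carrier R" using gens(2) that(1) .
    show "genrideal R (gens J) \<in> G" using gens(3) that(1) BG by auto
    show "K \<in> G" using that(2) BG by blast
  qed
  \<comment> \<open>\<open>carrier R\<close> is inserted only to make the base nonempty, as (T0) requires.\<close>
  obtain C where C: "\<beta> ` insert (carrier R) X \<subseteq> C" "C \<subseteq> B" "|C| \<le>o l"
    and closed: "\<And>I J. \<lbrakk>I \<in> C; J \<in> C\<rbrakk> \<Longrightarrow> \<Phi> I J \<subseteq> C"
  proof (rule small_closure[OF l, of "\<beta> ` insert (carrier R) X" B \<Phi>])
    show "\<beta> ` insert (carrier R) X \<subseteq> B" using X(1) T0 \<beta>(1) by blast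
    have "|insert (carrier R) X| \<le>o l"
      using card_of_Un_ordLeq_infinite_Field[OF l(2) _ X(2) l(1), of "{carrier R}"]
        finite_ordLeq_infinite_card[OF l, of "{carrier R}"] by simp
    then show "|\<beta> ` insert (carrier R) X| \<le>o l" using card_of_image ordLeq_transitive by blast
    fix I J assume IJ: "I \<in> B" "J \<in> B"
    then show "\<Phi> I J \<subseteq> B"
      using \<beta>(1) prod T2 BG F(1) unfolding \<Phi>_def by blast
    have "|\<beta> ` F I| \<le>o l" using F(2) IJ(1) BG card_of_image ordLeq_transitive by blast
    moreover have "|{\<beta> (I \<inter> J), \<beta> (prod I J)}| \<le>o l"
      using l by (rule finite_ordLeq_infinite_card) simp
    ultimately show "|\<Phi> I J| \<le>o l"
      unfolding \<Phi>_def using l by (intro card_of_Un_ordLeq_infinite_Field) auto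
  qed (rule that)
  define H where "H = {I. right_ideal I R \<and> (\<exists>J\<in>C. J \<subseteq> I)}"
  have CG: "C \<subseteq> G" using C(2) BG by blast
  have "right_gabriel_topology R H"
    unfolding H_def
  proof (rule right_gabriel_topology_of_base[of C gens])
    show "right_ideal I R" if "I \<in> C" for I using that CG right_ideals by blast
    show "C \<noteq> {}" using C(1) by blast
    show "finite (gens J)" if "J \<in> C" for J using that gens(1) C(2) by blast
    show "gens J \<subseteq> J" if "J \<in> C" for J
      using that gens(3) C(2) subset_genrideal[of "gens J" R] by blast
    show "\<exists>K\<in>C. K \<subseteq> I \<inter> J" if "I \<in> C" "J \<in> C" for I J
    proof (rule bexI)
      show "\<beta> (I \<inter> J) \<subseteq> I \<inter> J" using that CG T2 \<beta>(2) by blast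
      show "\<beta> (I \<inter> J) \<in> C" using closed[OF that] by (simp add: \<Phi>_def)
    qed
    show "\<exists>K\<in>C. s <# K \<subseteq> I" if I: "I \<in> C" and s: "s \<in> carrier R" for I s
    proof -
      obtain J where J: "J \<in> F I" "s <# J \<subseteq> I" using F(3) I s CG by blast
      have "J \<in> G" using F(1) I J(1) CG by blast
      then have "\<beta> J \<subseteq> J" by (rule \<beta>(2))
      then have "s <# \<beta> J \<subseteq> I" using J(2) by (auto simp: l_coset_def)
      moreover have "\<beta> J \<in> C" using closed[OF I I] J(1) by (auto simp: \<Phi>_def)
      ultimately show ?thesis by blast
    qed
    show "\<exists>L\<in>C. L \<subseteq> genrideal R (\<Union>s\<in>gens J. s <# K)" if "J \<in> C" "K \<in> C" for J K
    proof (rule bexI)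
      show "\<beta> (prod J K) \<subseteq> genrideal R (\<Union>s\<in>gens J. s <# K)"
        unfolding prod_def[symmetric] using that C(2) by (intro \<beta>(2) prod) auto
      show "\<beta> (prod J K) \<in> C" using closed[OF that] by (simp add: \<Phi>_def)
    qed
  qed
  moreover have "H \<subseteq> G" unfolding H_def using CG T1 by blast
  moreover have "topology_base H C"
    unfolding topology_base_def H_def using CG right_ideals by blast
  ultimately have "H \<in> small_subtopologies R l G"
    unfolding small_subtopologies_def using C(2,3) base(2) by blast
  moreover have "X \<subseteq> H"
  proof
    fix I assume "I \<in> X"
    then have "I \<in> G" "\<beta> I \<in> C" using X(1) C(1) by auto
    then show "I \<in> H" unfolding H_def using right_ideals \<beta>(2) by blast
  qed
  ultimately show thesis by (rule that)
qed

section \<open>Directedness and exhaustion\<close>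

theorem corollary3p5:
  fixes R :: "('a, 'b) ring_scheme" and l :: "'c rel" and G :: "'a set set"
  assumes "ring R"
    and "Card_order l" and "infinite (Field l)"
    and "right_gabriel_topology R G"
    and "cond_T R l G"
    and "\<exists>B. topology_base G B \<and> (\<forall>I\<in>B. fg_right_ideal R I)"
  shows "succ_directed l (small_subtopologies R l G) \<and>
         G = \<Union>(small_subtopologies R l G)"
proof
  interpret right_gabriel_topology R G by fact
  obtain B where B: "topology_base G B" "\<forall>I\<in>B. fg_right_ideal R I" using assms(6) by blast
  note small = ex_small_subtopology[OF assms(2,3,5) B]
  show "succ_directed l (small_subtopologies R l G)"
    unfolding succ_directed_def
  proof (intro allI impI)
    fix Y assume Y: "Y \<subseteq> small_subtopologies R l G" "|Y| \<le>o l"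
    then have "\<forall>H\<in>Y. \<exists>D. topology_base H D \<and> |D| \<le>o l"
      unfolding small_subtopologies_def by blast
    then obtain D where D: "\<And>H. H \<in> Y \<Longrightarrow> topology_base H (D H)" "\<And>H. H \<in> Y \<Longrightarrow> |D H| \<le>o l"
      by metis
    have YG: "H \<subseteq> G" if "H \<in> Y" for H using that Y(1) by (auto simp: small_subtopologies_def)
    have "(\<Union>H\<in>Y. D H) \<subseteq> G" using D(1) YG unfolding topology_base_def by blast
    moreover have "|\<Union>H\<in>Y. D H| \<le>o l"
      using D(2) Y(2) assms(2,3) by (intro card_of_UNION_ordLeq_infinite_Field) auto
    ultimately obtain U where U: "U \<in> small_subtopologies R l G" "(\<Union>H\<in>Y. D H) \<subseteq> U"
      by (rule small)
    interpret U: right_gabriel_topology R U using U(1) by (simp add: small_subtopologies_def)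
    have "H \<subseteq> U" if H: "H \<in> Y" for H
    proof
      fix I assume I: "I \<in> H"
      then obtain J where "J \<in> D H" "J \<subseteq> I" using D(1)[OF H] unfolding topology_base_def by blast
      moreover have "right_ideal I R" using I YG[OF H] right_ideals by blast
      ultimately show "I \<in> U" using U(2) H by (intro U.T1[of J I]) auto
    qed
    then show "\<exists>U\<in>small_subtopologies R l G. \<forall>H\<in>Y. H \<le> U" using U(1) by blast
  qed
  show "G = \<Union>(small_subtopologies R l G)"
  proof
    show "\<Union>(small_subtopologies R l G) \<subseteq> G" by (auto simp: small_subtopologies_def)
    show "G \<subseteq> \<Union>(small_subtopologies R l G)"
    proof
      fix I assume "I \<in> G"
      then obtain H where "H \<in> small_subtopologies R l G" "{I} \<subseteq> H"
        using small[of "{I}"] finite_ordLeq_infinite_card[OF assms(2,3), of "{I}"] by blast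
      then show "I \<in> \<Union>(small_subtopologies R l G)" by blast
    qed
  qed
qed

end
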